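(* For every finite abelian group $G$, $q(G)\le\mathsf D_2(G)$.
   Context: $G$ is a finite abelian group written additively. A sequence over $G$ is a finite unordered list of elements of $G$ with repetition allowed; a subsequence uses each element at most as often as the sequence does; two subsequences are disjoint if together they form a subsequence. $\mathcal B(G)$ is the set of all nonempty sequences over $G$ whose terms sum to $0$. For $\Omega\subset\mathcal B(G)$, $d_{\Omega}(G)$ is the smallest integer $t$ such that every sequence over $G$ of length at least $t$ has a subsequence belonging to $\Omega$ ($\infty$ if none exists). $\mathsf D(G)$ is the smallest $t$ such that every sequence over $G$ of length at least $t$ has a nonempty zero-sum subsequence. For an integer $t\ge\mathsf D(G)$, a sequence $S\in\mathcal B(G)$ is essential with respect to $t$ if every $\Omega\subset\mathcal B(G)$ with $d_\Omega(G)=t$ contains $S$. $q(G)$ is the smallest integer $t$ such that there is no sequence that is essential with respect to $t$. $\mathsf D_2(G)$ is the smallest integer $t$ such that every sequence over $G$ of length at least $t$ has two disjoint nonempty zero-sum subsequences.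
   Formalization: The group G is assumed nontrivial; for the trivial group the claim fails, since the sequence of t zeros is essential with respect to every t ≥ 1, so q(G) is infinite while D_2(G) = 2. *)

theory Defs
  imports Main "HOL-Library.Multiset" "HOL-Library.Extended_Nat"
begin

text \<open>
  The group is a type of class \<open>ab_group_add\<close>, a sequence over it is a finite multiset,
  subsequences are sub-multisets (\<open>\<subseteq>#\<close>), and \<open>U\<close> and \<open>V\<close> are disjoint subsequences of \<open>S\<close> iff
  \<open>U + V \<subseteq># S\<close>. The invariants depend on the group only, so they take a type argument.
  They are extended naturals, with value \<open>\<infinity>\<close> when there is no admissible integer (\<open>Inf {} = \<infinity>\<close>).
  No integer below 0 is ever admissible, so it is enough to let \<open>t\<close> range over \<open>nat\<close>.
\<close>

definition zero_sum_seqs :: "'a::ab_group_add multiset set" where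
  "zero_sum_seqs = {S. S \<noteq> {#} \<and> sum_mset S = 0}"

definition d_Omega :: "'a::ab_group_add multiset set \<Rightarrow> enat" where
  "d_Omega \<Omega> = Inf {enat t |t. \<forall>S :: 'a multiset. t \<le> size S \<longrightarrow> (\<exists>U. U \<subseteq># S \<and> U \<in> \<Omega>)}"

definition davenport :: "'a::ab_group_add itself \<Rightarrow> enat" where
  "davenport _ = Inf {enat t |t. \<forall>S :: 'a multiset. t \<le> size S \<longrightarrow>
     (\<exists>U. U \<subseteq># S \<and> U \<noteq> {#} \<and> sum_mset U = 0)}"

definition davenport2 :: "'a::ab_group_add itself \<Rightarrow> enat" where
  "davenport2 _ = Inf {enat t |t. \<forall>S :: 'a multiset. t \<le> size S \<longrightarrow>
     (\<exists>U V. U + V \<subseteq># S \<and> U \<noteq> {#} \<and> sum_mset U = 0 \<and> V \<noteq> {#} \<and> sum_mset V = 0)}"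

text \<open>Only meaningful for \<open>t \<ge> davenport TYPE('a)\<close>; this bound is imposed in \<open>q_const\<close>.\<close>

definition essential :: "nat \<Rightarrow> 'a::ab_group_add multiset \<Rightarrow> bool" where
  "essential t S \<longleftrightarrow> S \<in> zero_sum_seqs \<and>
     (\<forall>\<Omega>. \<Omega> \<subseteq> zero_sum_seqs \<and> d_Omega \<Omega> = enat t \<longrightarrow> S \<in> \<Omega>)"

definition q_const :: "'a::ab_group_add itself \<Rightarrow> enat" where
  "q_const _ = Inf {enat t |t. davenport TYPE('a) \<le> enat t \<and>
     \<not> (\<exists>S :: 'a multiset. essential t S)}"

text \<open>
  The trivial group is degenerate: the sequence consisting of \<open>t\<close> zeros is essential with respect
  to \<open>t\<close> for every \<open>t \<ge> 1\<close>, so no integer qualifies as the value of \<open>q_const\<close>, whereas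
  \<open>davenport2\<close> is at most 2.
\<close>

lemma q_const_trivial_group:
  assumes triv: "\<And>x::'a::ab_group_add. x = 0"
  shows "q_const TYPE('a) = \<infinity>"
proof -
  have rep: "S = replicate_mset (size S) 0" for S :: "'a multiset"
    by (induction S) (use triv in auto)
  have "\<exists>S :: 'a multiset. essential t S" if t: "davenport TYPE('a) \<le> enat t" for t
  proof (intro exI)
    let ?P = "\<lambda>t. \<forall>S :: 'a multiset. t \<le> size S \<longrightarrow>
      (\<exists>U. U \<subseteq># S \<and> U \<noteq> {#} \<and> sum_mset U = 0)"
    have "t \<noteq> 0"
    proof
      assume "t = 0"
      then have "davenport TYPE('a) < enat 1"
        using t by (metis enat_ord_simps(2) le_less_trans zero_less_one)
      then obtain s where "?P s" "s < 1"
        unfolding davenport_def Inf_less_iff by auto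
      then show False by (auto dest: spec[of _ "{#}"])
    qed
    show "essential t (replicate_mset t (0::'a))"
      unfolding essential_def
    proof (intro conjI allI impI)
      show "replicate_mset t (0::'a) \<in> zero_sum_seqs"
        using \<open>t \<noteq> 0\<close> triv by (simp add: zero_sum_seqs_def)
    next
      fix \<Omega> :: "'a multiset set"
      assume "\<Omega> \<subseteq> zero_sum_seqs \<and> d_Omega \<Omega> = enat t"
      then have d: "d_Omega \<Omega> = enat t" by simp
      let ?Q = "\<lambda>t. \<forall>S :: 'a multiset. t \<le> size S \<longrightarrow> (\<exists>U. U \<subseteq># S \<and> U \<in> \<Omega>)"
      have "d_Omega \<Omega> < enat (Suc t)" using d by simp
      then obtain s where s: "?Q s" "s \<le> t"
        unfolding d_Omega_def Inf_less_iff by auto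
      obtain U where U: "U \<subseteq># replicate_mset t 0" "U \<in> \<Omega>"
        using s by (metis size_replicate_mset)
      have "?Q (size U)"
      proof (intro allI impI)
        fix S :: "'a multiset"
        assume "size U \<le> size S"
        then have "replicate_mset (size U) 0 \<subseteq># replicate_mset (size S) (0::'a)"
          by (simp add: subseteq_mset_def)
        then show "\<exists>U. U \<subseteq># S \<and> U \<in> \<Omega>"
          using U(2) rep[of S] rep[of U] by auto
      qed
      then have "enat t \<le> enat (size U)"
        unfolding d[symmetric] d_Omega_def by (intro Inf_lower) blast
      moreover have "size U \<le> t" using size_mset_mono[OF U(1)] by simp
      ultimately have "U = replicate_mset t 0" using rep[of U] by simp
      then show "replicate_mset t 0 \<in> \<Omega>" using U(2) by simp
    qed
  qed
  then have "{enat t |t. davenport TYPE('a) \<le> enat t \<and> \<not> (\<exists>S :: 'a multiset. essential t S)} = {}"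
    by blast
  then show ?thesis unfolding q_const_def by (simp only: Inf_empty top_enat_def)
qed

lemma davenport2_trivial_group:
  assumes triv: "\<And>x::'a::ab_group_add. x = 0"
  shows "davenport2 TYPE('a) \<le> 2"
proof -
  have "\<exists>U V. U + V \<subseteq># S \<and> U \<noteq> {#} \<and> sum_mset U = 0 \<and> V \<noteq> {#} \<and> sum_mset V = 0"
    if "2 \<le> size S" for S :: "'a multiset"
  proof -
    obtain x S' where S': "S = add_mset x S'"
      using \<open>2 \<le> size S\<close> by (cases S) auto
    obtain y R where "S' = add_mset y R"
      using \<open>2 \<le> size S\<close> S' by (cases S') auto
    with S' have "S = add_mset x (add_mset y R)" by simp
    then have "{#x#} + {#y#} \<subseteq># S" by simp
    then show ?thesis using triv[of x] triv[of y] by (intro exI[of _ "{#x#}"] exI[of _ "{#y#}"]) auto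
  qed
  then have "davenport2 TYPE('a) \<le> enat 2"
    unfolding davenport2_def by (intro Inf_lower) blast
  then show ?thesis by (simp add: numeral_eq_enat)
qed

end

theory Submission
  imports Defs
begin

text \<open>
  Let \<open>t = D\<^sub>2(G)\<close>. For each zero-sum sequence \<open>S\<close> one needs a set \<open>\<Omega>\<close> of zero-sum sequences that
  omits \<open>S\<close> and has \<open>d\<^sub>\<Omega>(G) = t\<close>. Fix a sequence \<open>W\<close> of length \<open>t - 1\<close> and let \<open>\<Omega>\<close> consist of
  the zero-sum sequences other than \<open>S\<close> that are not contained in \<open>W\<close>; then \<open>d\<^sub>\<Omega>(G) \<ge> t\<close>, and
  \<open>W\<close> has to be chosen such that equality holds.

  If \<open>S\<close> has a nonzero term, \<open>W\<close> consists of a longest zero-sum free sequence, padded with zeros.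
  If all terms of \<open>S\<close> are zero, \<open>W\<close> is a sequence of length \<open>t - 1\<close> without two disjoint
  zero-sum subsequences and without the term \<open>0\<close>.
\<close>

text \<open>A finite infimum in \<open>enat\<close> is attained: lying below
  \<open>enat (Suc n)\<close>, it has an admissible \<open>s \<le> n\<close>, and being a lower
  bound it forces \<open>s = n\<close>.\<close>

lemma Inf_enat_eq_iff:
  "Inf {enat t |t. P t} = enat n \<longleftrightarrow> P n \<and> (\<forall>s<n. \<not> P s)"
proof
  assume inf: "Inf {enat t |t. P t} = enat n"
  then have "Inf {enat t |t. P t} < enat (Suc n)" by simp
  then obtain s where "P s" "s \<le> n"
    unfolding Inf_less_iff by auto
  moreover have least: "n \<le> s" if "P s" for s
  proof -
    have "Inf {enat t |t. P t} \<le> enat s" using that by (intro Inf_lower) blast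
    then show ?thesis using inf by simp
  qed
  ultimately show "P n \<and> (\<forall>s<n. \<not> P s)" using le_antisym not_less by metis
next
  assume n: "P n \<and> (\<forall>s<n. \<not> P s)"
  show "Inf {enat t |t. P t} = enat n"
  proof (rule antisym)
    show "Inf {enat t |t. P t} \<le> enat n" using n by (intro Inf_lower) blast
    show "enat n \<le> Inf {enat t |t. P t}"
      by (rule Inf_greatest) (use n in \<open>auto simp flip: not_less\<close>)
  qed
qed

text \<open>A single \<open>W\<close> of length \<open>t - 1\<close> suffices for the lower bound,
  since its length is at least \<open>s\<close> for every \<open>s < t\<close>.\<close>

lemma d_Omega_eqI:
  assumes "\<And>S. t \<le> size S \<Longrightarrow> \<exists>U. U \<subseteq># S \<and> U \<in> \<Omega>"
    and "Suc (size W) = t"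
    and "\<And>U. U \<subseteq># W \<Longrightarrow> U \<notin> \<Omega>"
  shows "d_Omega \<Omega> = enat t"
  unfolding d_Omega_def Inf_enat_eq_iff using assms less_Suc_eq_le by metis

definition zero_sum_free :: "'a::ab_group_add multiset \<Rightarrow> bool" where
  "zero_sum_free F \<longleftrightarrow> (\<forall>U. U \<subseteq># F \<longrightarrow> U \<notin> zero_sum_seqs)"

definition has_two_disjoint :: "'a::ab_group_add multiset \<Rightarrow> bool" where
  "has_two_disjoint R \<longleftrightarrow> (\<exists>U V. U + V \<subseteq># R \<and> U \<in> zero_sum_seqs \<and> V \<in> zero_sum_seqs)"

lemma sum_mset_replicate_mset_zero: "sum_mset (replicate_mset n (0::'a::comm_monoid_add)) = 0"
  by (induction n) auto

lemma zero_sum_seqs_add: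
  "U \<in> zero_sum_seqs \<Longrightarrow> V \<in> zero_sum_seqs \<Longrightarrow> U + V \<in> zero_sum_seqs"
  by (simp add: zero_sum_seqs_def)

lemma zero_sum_seqs_not_empty: "U \<in> zero_sum_seqs \<Longrightarrow> U \<noteq> {#}"
  by (simp add: zero_sum_seqs_def)

lemma zero_notin_zero_sum_free: "zero_sum_free F \<Longrightarrow> 0 \<notin># F"
  unfolding zero_sum_free_def zero_sum_seqs_def
  by (auto dest: spec[of _ "{#0#}"])

lemma davenport_eqD:
  assumes "davenport TYPE('a::ab_group_add) = enat D"
  shows "\<And>S :: 'a multiset. D \<le> size S \<Longrightarrow> \<not> zero_sum_free S"
    and "\<exists>F :: 'a multiset. Suc (size F) = D \<and> zero_sum_free F"
proof -
  have D: "(\<forall>S :: 'a multiset. D \<le> size S \<longrightarrow> \<not> zero_sum_free S) \<and>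
      (\<forall>s<D. \<not> (\<forall>S :: 'a multiset. s \<le> size S \<longrightarrow> \<not> zero_sum_free S))"
    using assms unfolding davenport_def Inf_enat_eq_iff
    by (simp add: zero_sum_free_def zero_sum_seqs_def)
  then show "\<And>S :: 'a multiset. D \<le> size S \<Longrightarrow> \<not> zero_sum_free S" by blast
  have "zero_sum_free ({#} :: 'a multiset)"
    by (simp add: zero_sum_free_def zero_sum_seqs_def)
  \<comment> \<open>The empty sequence is zero-sum free, so \<open>D\<close> is positive and the
    subtraction is not truncated.\<close>
  then have "D - 1 < D" using D by (cases D) auto
  then obtain F :: "'a multiset" where "D - 1 \<le> size F" "zero_sum_free F" using D by blast
  moreover from this have "size F < D" using D not_less by blast
  ultimately show "\<exists>F :: 'a multiset. Suc (size F) = D \<and> zero_sum_free F"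
    by (intro exI[of _ F]) auto
qed

lemma davenport2_eqD:
  assumes "davenport2 TYPE('a::ab_group_add) = enat t"
  shows "\<And>S :: 'a multiset. t \<le> size S \<Longrightarrow> has_two_disjoint S"
    and "\<exists>W :: 'a multiset. Suc (size W) = t \<and> \<not> has_two_disjoint W"
proof -
  have t: "(\<forall>S :: 'a multiset. t \<le> size S \<longrightarrow> has_two_disjoint S) \<and>
      (\<forall>s<t. \<not> (\<forall>S :: 'a multiset. s \<le> size S \<longrightarrow> has_two_disjoint S))"
    using assms unfolding davenport2_def Inf_enat_eq_iff
    by (simp add: has_two_disjoint_def zero_sum_seqs_def conj_assoc)
  then show "\<And>S :: 'a multiset. t \<le> size S \<Longrightarrow> has_two_disjoint S" by blast
  have "\<not> has_two_disjoint ({#} :: 'a multiset)"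
    by (simp add: has_two_disjoint_def zero_sum_seqs_def)
  then have "t - 1 < t" using t by (cases t) auto
  then obtain W :: "'a multiset" where "t - 1 \<le> size W" "\<not> has_two_disjoint W" using t by blast
  moreover from this have "size W < t" using t not_less by blast
  ultimately show "\<exists>W :: 'a multiset. Suc (size W) = t \<and> \<not> has_two_disjoint W"
    by (intro exI[of _ W]) auto
qed

text \<open>One of two disjoint zero-sum subsequences is already a witness for
  \<open>davenport\<close>. This gives the lower bound on \<open>t\<close> demanded in
  \<open>q_const\<close>.\<close>

lemma davenport_le_davenport2: "davenport TYPE('a::ab_group_add) \<le> davenport2 TYPE('a)"
  unfolding davenport_def davenport2_def
proof (rule Inf_superset_mono, safe)
  fix t
  assume t: "\<forall>S :: 'a multiset. t \<le> size S \<longrightarrow>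
    (\<exists>U V. U + V \<subseteq># S \<and> U \<noteq> {#} \<and> sum_mset U = 0 \<and> V \<noteq> {#} \<and> sum_mset V = 0)"
  have "\<exists>U. U \<subseteq># S \<and> U \<noteq> {#} \<and> sum_mset U = 0" if "t \<le> size S" for S :: "'a multiset"
    using t that mset_subset_eq_add_left subset_mset.order_trans by metis
  then show "\<exists>t'. enat t = enat t' \<and> (\<forall>S :: 'a multiset. t' \<le> size S \<longrightarrow>
      (\<exists>U. U \<subseteq># S \<and> U \<noteq> {#} \<and> sum_mset U = 0))"
    by blast
qed

text \<open>A zero-sum subsequence that misses some copy of \<open>g\<close> would lie in
  \<open>F\<close>. So each one uses up all copies of \<open>g\<close>, and two disjoint ones cannot
  coexist.\<close>

lemma zero_sum_free_add_not_two_disjoint: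
  assumes "zero_sum_free F"
  shows "\<not> has_two_disjoint (add_mset g F)"
proof
  assume "has_two_disjoint (add_mset g F)"
  then obtain U V where UV: "U + V \<subseteq># add_mset g F" "U \<in> zero_sum_seqs" "V \<in> zero_sum_seqs"
    unfolding has_two_disjoint_def by blast
  have "count F g < count X g" if "X \<subseteq># add_mset g F" "X \<in> zero_sum_seqs" for X
  proof (rule ccontr)
    assume "\<not> count F g < count X g"
    then have "X \<subseteq># F"
      using that(1) unfolding subseteq_mset_def by (metis count_add_mset not_less)
    then show False using assms that(2) unfolding zero_sum_free_def by blast
  qed
  moreover have "U \<subseteq># add_mset g F" "V \<subseteq># add_mset g F"
    using UV(1) mset_subset_eq_add_left mset_subset_eq_add_right subset_mset.order_trans by metis+
  ultimately have "count F g < count U g" "count F g < count V g" using UV by blast+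
  moreover have "count U g + count V g \<le> Suc (count F g)"
    using UV(1) unfolding subseteq_mset_def by (metis count_add_mset count_union)
  ultimately show False by simp
qed

text \<open>A zero in an extremal \<open>W\<close> can be traded for \<open>g\<close>: since
  \<open>{#0#}\<close> is itself zero-sum, the rest of \<open>W\<close> must be zero-sum free, and
  adding \<open>g\<close> to it restores the length.\<close>

lemma ex_long_not_two_disjoint_zero_notin:
  assumes "davenport2 TYPE('a::ab_group_add) = enat t" and "(g :: 'a) \<noteq> 0"
  shows "\<exists>W :: 'a multiset. Suc (size W) = t \<and> \<not> has_two_disjoint W \<and> 0 \<notin># W"
proof -
  obtain W :: "'a multiset" where W: "Suc (size W) = t" "\<not> has_two_disjoint W"
    using davenport2_eqD(2)[OF assms(1)] by blast
  show ?thesis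
  proof (cases "0 \<in># W")
    case True
    then obtain F where F: "W = add_mset 0 F" by (meson mset_add)
    have free: "zero_sum_free F"
      unfolding zero_sum_free_def
    proof (intro allI impI notI)
      fix U assume "U \<subseteq># F" "U \<in> zero_sum_seqs"
      then have "{#0#} + U \<subseteq># W" "{#0#} \<in> zero_sum_seqs" "U \<in> zero_sum_seqs"
        by (simp_all add: F zero_sum_seqs_def)
      then show False using W(2) unfolding has_two_disjoint_def by blast
    qed
    show ?thesis
      using W F assms(2) zero_sum_free_add_not_two_disjoint[OF free, of g]
        zero_notin_zero_sum_free[OF free]
      by (intro exI[of _ "add_mset g F"]) auto
  qed (use W in blast)
qed

lemma not_essential_zeros:
  assumes t: "davenport2 TYPE('a::ab_group_add) = enat t" and g: "(g :: 'a) \<noteq> 0"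
    and S: "set_mset S \<subseteq> {0 :: 'a}"
  shows "\<not> essential t S"
proof -
  obtain W :: "'a multiset" where W: "Suc (size W) = t" "\<not> has_two_disjoint W" "0 \<notin># W"
    using ex_long_not_two_disjoint_zero_notin[OF t g] by blast
  define \<Omega> where "\<Omega> = {T \<in> zero_sum_seqs. T \<noteq> S \<and> \<not> T \<subseteq># W}"
  have "d_Omega \<Omega> = enat t"
  proof (rule d_Omega_eqI[OF _ W(1)])
    fix R :: "'a multiset" assume "t \<le> size R"
    then obtain U V where UV: "U + V \<subseteq># R" "U \<in> zero_sum_seqs" "V \<in> zero_sum_seqs"
      using davenport2_eqD(1)[OF t] unfolding has_two_disjoint_def by blast
    show "\<exists>U. U \<subseteq># R \<and> U \<in> \<Omega>"
    proof (cases "U + V = S")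
      case False
      \<comment> \<open>\<open>U\<close> or \<open>V\<close> alone may lie in \<open>W\<close>, but
        their union cannot.\<close>
      have "\<not> U + V \<subseteq># W" using W(2) UV unfolding has_two_disjoint_def by blast
      then have "U + V \<in> \<Omega>" using False UV by (simp add: \<Omega>_def zero_sum_seqs_add)
      then show ?thesis using UV(1) by blast
    next
      \<comment> \<open>Here \<open>{#0#}\<close> replaces the union: it is not \<open>S\<close>,
        which has at least two terms, and it is not contained in \<open>W\<close>, which avoids
        0.\<close>
      case True
      have ne: "U \<noteq> {#}" "V \<noteq> {#}" using UV zero_sum_seqs_not_empty by blast+
      have "{#0#} \<noteq> S" using True ne single_is_union[of 0 U V] by simp
      moreover obtain x where "x \<in># U" using ne by blast
      then have "0 \<in># S" using S True by auto
      then have "{#0#} \<subseteq># R" using UV(1) True by (metis mset_subset_eqD mset_subset_eq_single)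
      ultimately have "{#0#} \<subseteq># R" "{#0#} \<in> \<Omega>" using W(3) by (auto simp: \<Omega>_def zero_sum_seqs_def)
      then show ?thesis by blast
    qed
  qed (simp add: \<Omega>_def)
  moreover have "\<Omega> \<subseteq> zero_sum_seqs" "S \<notin> \<Omega>" by (auto simp: \<Omega>_def)
  ultimately show ?thesis unfolding essential_def by blast
qed

lemma not_essential_not_zeros:
  assumes t: "davenport2 TYPE('a::ab_group_add) = enat t"
    and S: "\<not> set_mset S \<subseteq> {0 :: 'a}"
  shows "\<not> essential t S"
proof -
  obtain D where D: "davenport TYPE('a) = enat D" and Dt: "D \<le> t"
    using davenport_le_davenport2[where 'a='a] t by (cases "davenport TYPE('a)") auto
  obtain F :: "'a multiset" where F: "Suc (size F) = D" "zero_sum_free F"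
    using davenport_eqD(2)[OF D] by blast
  \<comment> \<open>The \<open>t - D\<close> zeros bring the length of \<open>F\<close>, which is
    \<open>D - 1\<close>, up to \<open>t - 1\<close>.\<close>
  define W where "W = replicate_mset (t - D) 0 + F"
  \<comment> \<open>The zero-sum subsequences of \<open>W\<close> are exactly the nonempty blocks of
    at most \<open>t - D\<close> zeros, so this condition says that \<open>T\<close> is not
    contained in \<open>W\<close>.\<close>
  define \<Omega> where "\<Omega> = {T \<in> zero_sum_seqs. T \<noteq> S \<and> (set_mset T \<subseteq> {0} \<longrightarrow> t - D < size T)}"
  have "d_Omega \<Omega> = enat t"
  proof (rule d_Omega_eqI)
    show "Suc (size W) = t" using F(1) Dt by (simp add: W_def)
  next
    fix T assume T: "T \<subseteq># W"
    show "T \<notin> \<Omega>"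
    proof
      assume "T \<in> \<Omega>"
      then have T0: "T \<in> zero_sum_seqs" and T1: "set_mset T \<subseteq> {0} \<longrightarrow> t - D < size T"
        by (auto simp: \<Omega>_def)
      \<comment> \<open>Deleting zeros keeps the sum, so the part left in \<open>F\<close> is
        zero-sum and must be empty.\<close>
      let ?T' = "filter_mset (\<lambda>x. x \<noteq> 0) T"
      have split: "T = replicate_mset (count T 0) 0 + ?T'"
        by (simp add: multiset_eq_iff)
      have "?T' \<subseteq># F"
        using T unfolding W_def subseteq_mset_def by (auto split: if_splits dest: spec)
      moreover have "sum_mset T = sum_mset ?T'"
        by (subst split) (simp only: sum_mset.union sum_mset_replicate_mset_zero add_0_left)
      ultimately have T'_empty: "?T' = {#}"
        using F(2) T0 unfolding zero_sum_free_def zero_sum_seqs_def by auto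
      have T_eq: "T = replicate_mset (count T 0) 0" by (rule split[unfolded T'_empty add_0_right])
      have "count T 0 \<le> count W 0" using T by (simp add: mset_subset_eq_count)
      moreover have "count W 0 = t - D"
        using zero_notin_zero_sum_free[OF F(2)] by (simp add: W_def not_in_iff)
      moreover have "size T = count T 0" "set_mset T \<subseteq> {0}"
        by (subst T_eq, simp)+
      ultimately show False using T1 by simp
    qed
  next
    fix R :: "'a multiset" assume R: "t \<le> size R"
    let ?R' = "filter_mset (\<lambda>x. x \<noteq> 0) R"
    have split: "R = replicate_mset (count R 0) 0 + ?R'"
      by (simp add: multiset_eq_iff)
    show "\<exists>U. U \<subseteq># R \<and> U \<in> \<Omega>"
    \<comment> \<open>Either the zeros of \<open>R\<close> alone form a member of
      \<open>\<Omega>\<close>, different from \<open>S\<close> by its nonzero term, or at least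
      \<open>t - (t - D) = D\<close> nonzero terms remain.\<close>
    proof (cases "t - D < count R 0")
      case True
      have "replicate_mset (count R 0) 0 \<subseteq># R" using split mset_subset_eq_add_left by metis
      moreover have "replicate_mset (count R 0) 0 \<in> \<Omega>"
        using True S by (auto simp: \<Omega>_def zero_sum_seqs_def sum_mset_replicate_mset_zero)
      ultimately show ?thesis by blast
    next
      case False
      have "size R = count R 0 + size ?R'" by (subst split) (simp only: size_union size_replicate_mset)
      then have "D \<le> size ?R'" using False R Dt by simp
      then obtain T where T: "T \<subseteq># ?R'" "T \<in> zero_sum_seqs"
        using davenport_eqD(1)[OF D] unfolding zero_sum_free_def by blast
      have TR: "T \<subseteq># R" using T(1) multiset_filter_subset subset_mset.order_trans by blast
      have sub: "\<not> set_mset X \<subseteq> {0}" if X: "X \<subseteq># ?R'" "X \<in> zero_sum_seqs" for X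
      proof -
        obtain x where "x \<in># X" using zero_sum_seqs_not_empty[OF X(2)] by blast
        then show ?thesis using mset_subset_eqD[OF X(1)] by auto
      qed
      show ?thesis
      proof (cases "T = S")
        case False
        then have "T \<in> \<Omega>" using T sub by (simp add: \<Omega>_def)
        then show ?thesis using TR by blast
      next
        case TS: True
        show ?thesis
        proof (cases "0 \<in># R")
          case True
          \<comment> \<open>Appending a zero to \<open>T = S\<close> keeps the sum and a nonzero
            term but changes the sequence.\<close>
          have "add_mset 0 T \<subseteq># R"
            unfolding subseteq_mset_def
          proof
            fix x
            have "count T x \<le> count ?R' x" using T(1) unfolding subseteq_mset_def by blast
            then show "count (add_mset 0 T) x \<le> count R x"
              using True by (auto split: if_splits simp: Suc_le_eq)
          qed
          moreover have "add_mset 0 T \<in> \<Omega>" using T(2) S TS by (auto simp: \<Omega>_def zero_sum_seqs_def)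
          ultimately show ?thesis by blast
        next
          case False
          then have RR: "?R' = R" by (auto simp: multiset_eq_iff not_in_iff)
          \<comment> \<open>Without zeros in \<open>R\<close>, every zero-sum subsequence except
            \<open>S\<close> is in \<open>\<Omega>\<close>. As \<open>V\<close> is nonempty,
            \<open>U\<close> and \<open>U + V\<close> cannot both equal \<open>S\<close>.\<close>
          obtain U V where UV: "U + V \<subseteq># R" "U \<in> zero_sum_seqs" "V \<in> zero_sum_seqs"
            using davenport2_eqD(1)[OF t R] unfolding has_two_disjoint_def by blast
          have "U \<subseteq># R" using UV(1) mset_subset_eq_add_left subset_mset.order_trans by metis
          moreover have "U \<noteq> S \<or> U + V \<noteq> S" using zero_sum_seqs_not_empty[OF UV(3)] by auto
          moreover have "X \<in> \<Omega>" if "X \<subseteq># R" "X \<in> zero_sum_seqs" "X \<noteq> S" for X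
            using that sub RR by (simp add: \<Omega>_def)
          ultimately show ?thesis using UV zero_sum_seqs_add by metis
        qed
      qed
    qed
  qed
  moreover have "\<Omega> \<subseteq> zero_sum_seqs" "S \<notin> \<Omega>" by (auto simp: \<Omega>_def)
  ultimately show ?thesis unfolding essential_def by blast
qed

theorem theorem4p4:
  assumes nontrivial: "\<exists>g :: 'a::{ab_group_add,finite}. g \<noteq> 0"
  shows "q_const TYPE('a) \<le> davenport2 TYPE('a)"
proof (cases "davenport2 TYPE('a)")
  case (enat t)
  have "davenport TYPE('a) \<le> enat t" using davenport_le_davenport2[where 'a='a] enat by simp
  \<comment> \<open>Nontriviality supplies the \<open>g\<close> for the case in which all terms of
    \<open>S\<close> are zero.\<close>
  moreover have "\<not> (\<exists>S :: 'a multiset. essential t S)"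
    using not_essential_zeros[OF enat] not_essential_not_zeros[OF enat] nontrivial by blast
  ultimately have "q_const TYPE('a) \<le> enat t"
    unfolding q_const_def by (intro Inf_lower) blast
  then show ?thesis using enat by simp
qed simp

end
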